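(* Let $G$ be an abelian topological group. The operations of multiplication $(T,S)\mapsto TS$ and inversion $T\mapsto T^{-1}$ are continuous in $\mathsf{Hom}_{\mathsf{bb}}(G)$ with respect to the topology of uniform convergence on bounded sets.
   Context: $e_G$ denotes the identity element of $G$. A subset $B$ of a topological group $G$ is bounded if for each neighborhood $U$ of $e_G$ there is a positive integer $n$ with $B\subset U^n$, where $U^n=\{u_1\cdots u_n:u_i\in U\}$. A (not necessarily continuous) group homomorphism $T:G\to G$ is $\mathsf{bb}$-bounded if for every bounded set $B\subset G$, $T(B)$ is bounded in $G$. $\mathsf{Hom}_{\mathsf{bb}}(G)$ is the set of all $\mathsf{bb}$-bounded homomorphisms $G\to G$. For homomorphisms $T,S$ on $G$, the operations are pointwise: $(TS)(x):=T(x)S(x)$ and $T^{-1}(x):=(T(x))^{-1}$ for $x\in G$. $\mathsf{Hom}_{\mathsf{bb}}(G)$ is endowed with the topology of uniform convergence on bounded sets: a net $(S_\alpha)$ converges to $S$ if for each bounded set $B\subset G$ and each neighborhood $V$ of $e_G$ there is an $\alpha_0$ with $(S_\alpha S^{-1})(B)\subset V$ for each $\alpha\ge\alpha_0$. *)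

theory Defs
  imports "HOL-Analysis.Analysis"
begin

text \<open>
  Abelian topological groups are types of class \<open>topological_ab_group_add\<close>, so the group is written
  additively: \<open>0\<close> is the identity and \<open>U\<^sup>n\<close> is the set of sums of \<open>n\<close> elements of \<open>U\<close>.
  No separation axiom is assumed, and neighbourhoods need not be open.
\<close>

definition nbhd_zero :: "'a::topological_ab_group_add set \<Rightarrow> bool" where
  "nbhd_zero U \<longleftrightarrow> (\<exists>W. open W \<and> 0 \<in> W \<and> W \<subseteq> U)"

definition set_pow :: "'a::topological_ab_group_add set \<Rightarrow> nat \<Rightarrow> 'a set" where
  "set_pow U n = {\<Sum>i<n. u i | u. \<forall>i<n. u i \<in> U}"

definition group_bounded :: "'a::topological_ab_group_add set \<Rightarrow> bool" where
  "group_bounded B \<longleftrightarrow> (\<forall>U. nbhd_zero U \<longrightarrow> (\<exists>n>0. B \<subseteq> set_pow U n))"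

definition Hom_bb :: "('a::topological_ab_group_add \<Rightarrow> 'a) set" where
  "Hom_bb = {T. Modules.additive T \<and> (\<forall>B. group_bounded B \<longrightarrow> group_bounded (T ` B))}"

definition unif_nbhd ::
    "('a::topological_ab_group_add \<Rightarrow> 'a) \<Rightarrow> 'a set \<Rightarrow> 'a set \<Rightarrow> ('a \<Rightarrow> 'a) set" where
  "unif_nbhd S B V = {T \<in> Hom_bb. (\<lambda>x. T x - S x) ` B \<subseteq> V}"

text \<open>
  The topology of uniform convergence on bounded sets: the sets \<open>unif_nbhd S B V\<close>, with \<open>B\<close> bounded
  and \<open>V\<close> a neighbourhood of \<open>0\<close>, form a neighbourhood base at \<open>S\<close>. The lemma \<open>limitin_Hom_bb\<close>
  below recovers the description of this topology by convergence of nets (as filters).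
\<close>

definition Hom_bb_topology :: "('a::topological_ab_group_add \<Rightarrow> 'a) topology" where
  "Hom_bb_topology = topology (\<lambda>W. W \<subseteq> Hom_bb \<and>
     (\<forall>S\<in>W. \<exists>B V. group_bounded B \<and> nbhd_zero V \<and> unif_nbhd S B V \<subseteq> W))"

lemma nbhd_zeroD: "nbhd_zero U \<Longrightarrow> 0 \<in> U"
  by (auto simp: nbhd_zero_def)

lemma nbhd_zero_UNIV: "nbhd_zero UNIV"
  by (auto simp: nbhd_zero_def)

lemma nbhd_zero_Int:
  assumes "nbhd_zero U" "nbhd_zero V"
  shows "nbhd_zero (U \<inter> V)"
proof -
  obtain A C where "open A" "0 \<in> A" "A \<subseteq> U" "open C" "0 \<in> C" "C \<subseteq> V"
    using assms by (auto simp: nbhd_zero_def)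
  then have "open (A \<inter> C) \<and> 0 \<in> A \<inter> C \<and> A \<inter> C \<subseteq> U \<inter> V" by auto
  then show ?thesis unfolding nbhd_zero_def by blast
qed

lemma nbhd_zero_half:
  assumes "nbhd_zero (U :: 'a::topological_ab_group_add set)"
  obtains V where "nbhd_zero V" "\<And>x y. x \<in> V \<Longrightarrow> y \<in> V \<Longrightarrow> x + y \<in> U"
proof -
  obtain A where A: "open A" "0 \<in> A" "A \<subseteq> U"
    using assms by (auto simp: nbhd_zero_def)
  have "((\<lambda>p. fst p + snd p) \<longlongrightarrow> (0::'a) + 0) (nhds 0 \<times>\<^sub>F nhds 0)"
    by (rule tendsto_add_Pair[unfolded case_prod_unfold])
  then have "eventually (\<lambda>p. fst p + snd p \<in> A) (nhds (0::'a) \<times>\<^sub>F nhds 0)"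
    using A by (auto simp: tendsto_def)
  then obtain P Q where PQ: "eventually P (nhds (0::'a))" "eventually Q (nhds (0::'a))"
    "\<And>x y. P x \<Longrightarrow> Q y \<Longrightarrow> x + y \<in> A"
    by (auto simp: eventually_prod_filter)
  obtain C where C: "open C" "0 \<in> C" "\<forall>x\<in>C. P x \<and> Q x"
    using eventually_conj[OF PQ(1,2)] by (auto simp: eventually_nhds)
  show ?thesis
  proof
    show "nbhd_zero C" using C by (auto simp: nbhd_zero_def)
    show "x + y \<in> U" if "x \<in> C" "y \<in> C" for x y using that C PQ(3) A by blast
  qed
qed

lemma set_pow_mono:
  assumes "0 \<in> U" "m \<le> n"
  shows "set_pow U m \<subseteq> set_pow U n"
proof
  fix x assume "x \<in> set_pow U m"
  then obtain u where u: "x = (\<Sum>i<m. u i)" "\<forall>i<m. u i \<in> U" by (auto simp: set_pow_def)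
  have "x = (\<Sum>i<n. if i < m then u i else 0)"
    unfolding u(1) by (rule sum.mono_neutral_cong_left) (use assms in auto)
  moreover have "\<forall>i<n. (if i < m then u i else 0) \<in> U" using u assms by auto
  ultimately show "x \<in> set_pow U n" unfolding set_pow_def by blast
qed

lemma group_bounded_empty: "group_bounded {}"
  unfolding group_bounded_def by auto

lemma group_bounded_Un:
  assumes "group_bounded A" "group_bounded B"
  shows "group_bounded (A \<union> B)"
  unfolding group_bounded_def
proof (intro allI impI)
  fix U :: "'a set" assume U: "nbhd_zero U"
  obtain m n where mn: "m > 0" "A \<subseteq> set_pow U m" "n > 0" "B \<subseteq> set_pow U n"
    using assms U unfolding group_bounded_def by meson
  have "A \<union> B \<subseteq> set_pow U (max m n)"
    using mn set_pow_mono[OF nbhd_zeroD[OF U], of m "max m n"]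
      set_pow_mono[OF nbhd_zeroD[OF U], of n "max m n"] by auto
  then show "\<exists>k>0. A \<union> B \<subseteq> set_pow U k" using mn by (metis less_max_iff_disj)
qed

lemma openin_Hom_bb:
  "openin Hom_bb_topology W \<longleftrightarrow> W \<subseteq> Hom_bb \<and>
     (\<forall>S\<in>W. \<exists>B V. group_bounded B \<and> nbhd_zero V \<and> unif_nbhd S B V \<subseteq> W)"
proof -
  define P :: "('a \<Rightarrow> 'a) set \<Rightarrow> bool" where "P = (\<lambda>W. W \<subseteq> Hom_bb \<and>
     (\<forall>S\<in>W. \<exists>B V. group_bounded B \<and> nbhd_zero V \<and> unif_nbhd S B V \<subseteq> W))"
  have PI: "P W"
    if "W \<subseteq> Hom_bb"
      "\<And>S. S \<in> W \<Longrightarrow> \<exists>B V. group_bounded B \<and> nbhd_zero V \<and> unif_nbhd S B V \<subseteq> W" for W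
    using that by (simp add: P_def)
  have PH: "W \<subseteq> Hom_bb" if "P W" for W using that by (simp add: P_def)
  have PE: "\<exists>B V. group_bounded B \<and> nbhd_zero V \<and> unif_nbhd S B V \<subseteq> W"
    if "P W" "S \<in> W" for S W using that by (simp add: P_def)
  have "P (W \<inter> X)" if W: "P W" and X: "P X" for W X
  proof (rule PI)
    show "W \<inter> X \<subseteq> Hom_bb" using PH[OF W] by auto
    fix S assume S: "S \<in> W \<inter> X"
    obtain B V where 1: "group_bounded B" "nbhd_zero V" "unif_nbhd S B V \<subseteq> W"
      using PE[OF W, of S] S by auto
    obtain B' V' where 2: "group_bounded B'" "nbhd_zero V'" "unif_nbhd S B' V' \<subseteq> X"
      using PE[OF X, of S] S by auto
    have "unif_nbhd S (B \<union> B') (V \<inter> V') \<subseteq> unif_nbhd S B V \<inter> unif_nbhd S B' V'"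
      by (auto simp: unif_nbhd_def)
    then have "unif_nbhd S (B \<union> B') (V \<inter> V') \<subseteq> W \<inter> X" using 1(3) 2(3) by auto
    then show "\<exists>B V. group_bounded B \<and> nbhd_zero V \<and> unif_nbhd S B V \<subseteq> W \<inter> X"
      using group_bounded_Un[OF 1(1) 2(1)] nbhd_zero_Int[OF 1(2) 2(2)] by (intro exI conjI)
  qed
  moreover have "P (\<Union>K)" if K: "\<forall>W\<in>K. P W" for K
  proof (rule PI)
    show "\<Union>K \<subseteq> Hom_bb" using K PH by (intro Union_least) auto
    fix S assume "S \<in> \<Union>K"
    then obtain W where W: "W \<in> K" "S \<in> W" by auto
    then obtain B V where BV: "group_bounded B" "nbhd_zero V" "unif_nbhd S B V \<subseteq> W"
      using PE[of W S] K by auto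
    then show "\<exists>B V. group_bounded B \<and> nbhd_zero V \<and> unif_nbhd S B V \<subseteq> \<Union>K"
      using Union_upper[OF W(1)] by (intro exI[of _ B] exI[of _ V]) auto
  qed
  ultimately have "istopology P" unfolding istopology_def by simp
  then have "openin Hom_bb_topology = P"
    unfolding Hom_bb_topology_def P_def[symmetric] by (rule topology_inverse')
  then show ?thesis by (simp add: P_def)
qed

lemma topspace_Hom_bb [simp]: "topspace Hom_bb_topology = Hom_bb"
proof -
  have "openin Hom_bb_topology (Hom_bb :: ('a \<Rightarrow> 'a) set)"
    unfolding openin_Hom_bb
    using group_bounded_empty nbhd_zero_UNIV by (auto simp: unif_nbhd_def)
  then have "Hom_bb \<subseteq> topspace (Hom_bb_topology :: ('a \<Rightarrow> 'a) topology)"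
    by (rule openin_subset)
  moreover have "topspace (Hom_bb_topology :: ('a \<Rightarrow> 'a) topology) \<subseteq> Hom_bb"
    using openin_topspace[of "Hom_bb_topology :: ('a \<Rightarrow> 'a) topology"]
    by (simp only: openin_Hom_bb)
  ultimately show ?thesis by (rule subset_antisym[rotated])
qed

lemma limitin_Hom_bb:
  "limitin Hom_bb_topology f S F \<longleftrightarrow>
     S \<in> Hom_bb \<and> eventually (\<lambda>a. f a \<in> Hom_bb) F \<and>
     (\<forall>B V. group_bounded B \<longrightarrow> nbhd_zero V \<longrightarrow>
        eventually (\<lambda>a. (\<lambda>x. f a x - S x) ` B \<subseteq> V) F)"
    (is "?L \<longleftrightarrow> ?R")
proof
  assume L: ?L
  then have S: "S \<in> Hom_bb" by (simp add: limitin_def)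
  have ev: "eventually (\<lambda>a. f a \<in> unif_nbhd S B V) F"
    if B: "group_bounded B" and V: "nbhd_zero V" for B V
  proof -
    define W where "W = {T \<in> Hom_bb. \<exists>V'. nbhd_zero V' \<and> unif_nbhd T B V' \<subseteq> unif_nbhd S B V}"
    have "openin Hom_bb_topology W"
      unfolding openin_Hom_bb
    proof (intro conjI ballI)
      show "W \<subseteq> Hom_bb" by (auto simp: W_def)
      fix T assume "T \<in> W"
      then obtain V' where V': "nbhd_zero V'" "unif_nbhd T B V' \<subseteq> unif_nbhd S B V"
        by (auto simp: W_def)
      obtain H where H: "nbhd_zero H" "\<And>x y. x \<in> H \<Longrightarrow> y \<in> H \<Longrightarrow> x + y \<in> V'"
        using nbhd_zero_half[OF V'(1)] by blast
      have "R \<in> W" if R: "R \<in> unif_nbhd T B H" for R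
      proof -
        have "Q \<in> unif_nbhd T B V'" if Q: "Q \<in> unif_nbhd R B H" for Q
        proof -
          have "Q x - T x \<in> V'" if "x \<in> B" for x
            using H(2)[of "Q x - R x" "R x - T x"] Q R that by (auto simp: unif_nbhd_def)
          then show ?thesis using Q by (auto simp: unif_nbhd_def)
        qed
        then have "unif_nbhd R B H \<subseteq> unif_nbhd S B V" using V'(2) by blast
        moreover have "R \<in> Hom_bb" using R by (simp add: unif_nbhd_def)
        ultimately show ?thesis using H(1) unfolding W_def by blast
      qed
      then show "\<exists>B V. group_bounded B \<and> nbhd_zero V \<and> unif_nbhd T B V \<subseteq> W"
        using B H(1) by blast
    qed
    moreover have "S \<in> W" using S V by (auto simp: W_def)
    ultimately have "eventually (\<lambda>a. f a \<in> W) F" using L by (auto simp: limitin_def)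
    moreover have "T \<in> unif_nbhd S B V" if T: "T \<in> W" for T
    proof -
      obtain V' where V': "nbhd_zero V'" "unif_nbhd T B V' \<subseteq> unif_nbhd S B V"
        using T unfolding W_def by blast
      have "T \<in> unif_nbhd T B V'"
        using T nbhd_zeroD[OF V'(1)] by (auto simp: W_def unif_nbhd_def)
      then show ?thesis using V'(2) by blast
    qed
    ultimately show ?thesis by (rule eventually_mono)
  qed
  have "eventually (\<lambda>a. f a \<in> Hom_bb) F"
    using ev[OF group_bounded_empty nbhd_zero_UNIV] by (simp add: unif_nbhd_def)
  moreover have "eventually (\<lambda>a. (\<lambda>x. f a x - S x) ` B \<subseteq> V) F"
    if "group_bounded B" "nbhd_zero V" for B V
    using ev[OF that] by (rule eventually_mono) (simp add: unif_nbhd_def)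
  ultimately show ?R using S by blast
next
  assume R: ?R
  show ?L
    unfolding limitin_def
  proof (intro conjI allI impI)
    show "S \<in> topspace Hom_bb_topology" using R by simp
    fix W assume W: "openin Hom_bb_topology W \<and> S \<in> W"
    then obtain B V where BV: "group_bounded B" "nbhd_zero V" "unif_nbhd S B V \<subseteq> W"
      by (auto simp: openin_Hom_bb)
    have "eventually (\<lambda>a. f a \<in> Hom_bb) F" "eventually (\<lambda>a. (\<lambda>x. f a x - S x) ` B \<subseteq> V) F"
      using R BV by blast+
    then show "eventually (\<lambda>a. f a \<in> W) F"
      by eventually_elim (use BV(3) in \<open>auto simp: unif_nbhd_def\<close>)
  qed
qed

end

theory Submission
  imports Defs
begin

text \<open>
  Continuity is tested on convergence along filters, where the topology has the transparent
  description \<open>limitin_Hom_bb\<close>. If \<open>f a\<close> tends to \<open>S\<close> and \<open>g a\<close> tends to \<open>T\<close>, then, because the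
  group is abelian, the error \<open>(f a x + g a x) - (S x + T x)\<close> is the sum of the two separate
  errors. Given a neighbourhood \<open>V\<close> of \<open>0\<close> and a bounded set \<open>B\<close>, choose \<open>W\<close> with
  \<open>W + W \<subseteq> V\<close>: once both errors are in \<open>W\<close> uniformly on \<open>B\<close>, the error of the sum is in \<open>V\<close>
  uniformly on \<open>B\<close>. For inversion, the error changes sign, so \<open>- V\<close> takes the place of \<open>W\<close>.

  The operations must also stay inside \<open>Hom_bb\<close>. This holds because \<open>U\<^sup>m + U\<^sup>n \<subseteq> U\<^sup>m\<^sup>+\<^sup>n\<close>, and because
  \<open>(- U)\<^sup>n = - U\<^sup>n\<close>; commutativity makes the pointwise sum and inverse of homomorphisms homomorphisms.
\<close>

lemma nbhd_zero_uminus_vimage: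
  assumes "nbhd_zero (U :: 'a::topological_ab_group_add set)"
  shows "nbhd_zero (uminus -` U)"
proof -
  obtain W where W: "open W" "0 \<in> W" "W \<subseteq> U"
    using assms by (auto simp: nbhd_zero_def)
  have "open (uminus -` W)"
    using W(1) by (intro open_vimage continuous_intros)
  moreover have "0 \<in> uminus -` W" "uminus -` W \<subseteq> uminus -` U"
    using W by auto
  ultimately show ?thesis unfolding nbhd_zero_def by blast
qed

lemma set_pow_add:
  assumes "x \<in> set_pow U m" "y \<in> set_pow U n"
  shows "x + y \<in> set_pow U (m + n)"
proof -
  obtain u v where u: "x = (\<Sum>i<m. u i)" "\<forall>i<m. u i \<in> U"
    and v: "y = (\<Sum>i<n. v i)" "\<forall>i<n. v i \<in> U"
    using assms by (auto simp: set_pow_def)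
  define w where "w = (\<lambda>i. if i < m then u i else v (i - m))"
  have "(\<Sum>i<m + n. w i) = (\<Sum>i<m. w i) + (\<Sum>i<n. w (m + i))"
    by (induction n) (simp_all add: add.assoc)
  then have "x + y = (\<Sum>i<m + n. w i)"
    by (simp add: u v w_def)
  moreover have "\<forall>i<m + n. w i \<in> U"
    using u v by (auto simp: w_def)
  ultimately show ?thesis unfolding set_pow_def by blast
qed

lemma set_pow_uminus:
  assumes "x \<in> set_pow (uminus -` U) n"
  shows "- x \<in> set_pow U n"
proof -
  obtain u where u: "x = (\<Sum>i<n. u i)" "\<forall>i<n. - u i \<in> U"
    using assms by (auto simp: set_pow_def)
  then have "- x = (\<Sum>i<n. - u i)" by (simp add: sum_negf)
  with u(2) show ?thesis
    unfolding set_pow_def by (intro CollectI exI[of _ "\<lambda>i. - u i"] conjI)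
qed

text \<open>
  The exponents that \<open>f ` B\<close> and \<open>g ` B\<close> need for the same \<open>U\<close> add up. This is why bounded sets lead
  to a group of homomorphisms even though no scalar multiplication is available for rescaling \<open>U\<close>.
\<close>

lemma group_bounded_image_add:
  assumes "group_bounded (f ` B)" "group_bounded (g ` B)"
  shows "group_bounded ((\<lambda>x. f x + g x) ` B)"
  unfolding group_bounded_def
proof (intro allI impI)
  fix U :: "'a set" assume "nbhd_zero U"
  then obtain m n where mn: "m > 0" "f ` B \<subseteq> set_pow U m" "g ` B \<subseteq> set_pow U n"
    using assms unfolding group_bounded_def by meson
  have "(\<lambda>x. f x + g x) ` B \<subseteq> set_pow U (m + n)"
    using mn(2,3) by (auto intro!: set_pow_add)
  with mn(1) show "\<exists>k>0. (\<lambda>x. f x + g x) ` B \<subseteq> set_pow U k"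
    by (intro exI[of _ "m + n"]) simp
qed

lemma group_bounded_image_uminus:
  assumes "group_bounded (f ` B)"
  shows "group_bounded ((\<lambda>x. - f x) ` B)"
  unfolding group_bounded_def
proof (intro allI impI)
  fix U :: "'a set" assume "nbhd_zero U"
  then obtain n where n: "n > 0" "f ` B \<subseteq> set_pow (uminus -` U) n"
    using assms nbhd_zero_uminus_vimage unfolding group_bounded_def by meson
  have "(\<lambda>x. - f x) ` B \<subseteq> set_pow U n"
    using n(2) by (auto intro!: set_pow_uminus)
  with n(1) show "\<exists>k>0. (\<lambda>x. - f x) ` B \<subseteq> set_pow U k" by blast
qed

lemma Hom_bb_add:
  assumes "T \<in> Hom_bb" "S \<in> Hom_bb"
  shows "(\<lambda>x. T x + S x) \<in> Hom_bb"
  using assms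
  by (auto simp: Hom_bb_def Modules.additive_def algebra_simps intro: group_bounded_image_add)

lemma Hom_bb_uminus:
  assumes "T \<in> Hom_bb"
  shows "(\<lambda>x. - T x) \<in> Hom_bb"
  using assms
  by (auto simp: Hom_bb_def Modules.additive_def algebra_simps intro: group_bounded_image_uminus)

text \<open>
  Stated for an arbitrary filter, this is joint continuity of addition: for the neighbourhood filter
  of a pair in the product topology, \<open>f\<close> and \<open>g\<close> become the two projections.
\<close>

lemma limitin_Hom_bb_add:
  assumes f: "limitin Hom_bb_topology f S F" and g: "limitin Hom_bb_topology g T F"
  shows "limitin Hom_bb_topology (\<lambda>a x. f a x + g a x) (\<lambda>x. S x + T x) F"
  unfolding limitin_Hom_bb
proof (intro conjI allI impI)
  show "(\<lambda>x. S x + T x) \<in> Hom_bb"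
    using f g by (simp add: limitin_Hom_bb Hom_bb_add)
  have "eventually (\<lambda>a. f a \<in> Hom_bb) F" "eventually (\<lambda>a. g a \<in> Hom_bb) F"
    using f g by (simp_all add: limitin_Hom_bb)
  then show "eventually (\<lambda>a. (\<lambda>x. f a x + g a x) \<in> Hom_bb) F"
    by eventually_elim (rule Hom_bb_add)
  fix B V :: "'a set" assume B: "group_bounded B" and V: "nbhd_zero V"
  obtain W where W: "nbhd_zero W" "\<And>x y. x \<in> W \<Longrightarrow> y \<in> W \<Longrightarrow> x + y \<in> V"
    using nbhd_zero_half[OF V] by blast
  have "eventually (\<lambda>a. (\<lambda>x. f a x - S x) ` B \<subseteq> W) F"
    "eventually (\<lambda>a. (\<lambda>x. g a x - T x) ` B \<subseteq> W) F"
    using f g B W(1) by (simp_all add: limitin_Hom_bb)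
  then show "eventually (\<lambda>a. (\<lambda>x. f a x + g a x - (S x + T x)) ` B \<subseteq> V) F"
  proof eventually_elim
    case (elim a)
    then show ?case by (auto simp: add_diff_add intro!: W(2))
  qed
qed

lemma limitin_Hom_bb_uminus:
  assumes f: "limitin Hom_bb_topology f S F"
  shows "limitin Hom_bb_topology (\<lambda>a x. - f a x) (\<lambda>x. - S x) F"
  unfolding limitin_Hom_bb
proof (intro conjI allI impI)
  show "(\<lambda>x. - S x) \<in> Hom_bb"
    using f by (simp add: limitin_Hom_bb Hom_bb_uminus)
  have "eventually (\<lambda>a. f a \<in> Hom_bb) F"
    using f by (simp add: limitin_Hom_bb)
  then show "eventually (\<lambda>a. (\<lambda>x. - f a x) \<in> Hom_bb) F"
    by eventually_elim (rule Hom_bb_uminus)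
  fix B V :: "'a set" assume B: "group_bounded B" and V: "nbhd_zero V"
  have "eventually (\<lambda>a. (\<lambda>x. f a x - S x) ` B \<subseteq> uminus -` V) F"
    using f B nbhd_zero_uminus_vimage[OF V] by (simp add: limitin_Hom_bb)
  then show "eventually (\<lambda>a. (\<lambda>x. - f a x - - S x) ` B \<subseteq> V) F"
    by eventually_elim auto
qed

theorem theorem2p8:
  shows "continuous_map
           (prod_topology Hom_bb_topology Hom_bb_topology)
           (Hom_bb_topology :: ('a::topological_ab_group_add \<Rightarrow> 'a) topology)
           (\<lambda>(T, S). \<lambda>x. T x + S x) \<and>
         continuous_map
           Hom_bb_topology
           (Hom_bb_topology :: ('a \<Rightarrow> 'a) topology)
           (\<lambda>T. \<lambda>x. - T x)"
proof
  let ?H = "Hom_bb_topology :: ('a \<Rightarrow> 'a) topology"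
  show "continuous_map (prod_topology ?H ?H) ?H (\<lambda>(T, S). \<lambda>x. T x + S x)"
    unfolding continuous_map_atin case_prod_unfold
  proof
    fix p assume p: "p \<in> topspace (prod_topology ?H ?H)"
    have "limitin ?H fst (fst p) (atin (prod_topology ?H ?H) p)"
      "limitin ?H snd (snd p) (atin (prod_topology ?H ?H) p)"
      using p continuous_map_fst[of ?H ?H] continuous_map_snd[of ?H ?H]
      unfolding continuous_map_atin by blast+
    then show "limitin ?H (\<lambda>p x. fst p x + snd p x) (\<lambda>x. fst p x + snd p x)
        (atin (prod_topology ?H ?H) p)"
      by (rule limitin_Hom_bb_add)
  qed
  show "continuous_map ?H ?H (\<lambda>T x. - T x)"
    unfolding continuous_map_atin
  proof
    fix T assume T: "T \<in> topspace ?H"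
    have "limitin ?H (\<lambda>T. T) T (atin ?H T)"
      using T continuous_map_id[of ?H] unfolding continuous_map_atin id_def by blast
    then show "limitin ?H (\<lambda>T x. - T x) (\<lambda>x. - T x) (atin ?H T)"
      by (rule limitin_Hom_bb_uminus)
  qed
qed

end
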